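(* For any connected graph $G$ of order $n\geq 3$ and any graph $H$, $$\gamma_{\times 2}(G\circ H)\leq 2\left\lfloor\frac{2n}{3}\right\rfloor.$$
   Context: All graphs are finite, undirected, without loops or multiple edges, and have at least one vertex. The order of a graph is its number of vertices. The lexicographic product $G\circ H$ has vertex set $V(G)\times V(H)$, and $(u,v)$ is adjacent to $(x,y)$ if and only if $ux\in E(G)$, or $u=x$ and $vy\in E(H)$. A vertex dominates itself and its neighbours. For a graph $F$ with no isolated vertex, $\gamma_{\times 2}(F)$ is the minimum cardinality of a double dominating set of $F$, i.e. a set $S\subseteq V(F)$ such that every vertex of $F$ is dominated by at least two vertices of $S$. *)

theory Defs
  imports Complex_Main "Graph_Theory.Digraph_Component"
begin

text \<open>
  A finite simple graph is a \<^locale>\<open>pair_graph\<close>: a finite vertex set with a symmetric,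
  irreflexive arc relation, each undirected edge being a pair of opposite arcs. The locale
  admits the empty graph, so nonemptiness has to be assumed separately.
\<close>

definition lexicographic_product ::
  "'a pair_pre_digraph \<Rightarrow> 'b pair_pre_digraph \<Rightarrow> ('a \<times> 'b) pair_pre_digraph" where
  "lexicographic_product G H =
    \<lparr> pverts = pverts G \<times> pverts H,
      parcs = {((u, v), (x, y)) | u v x y.
        u \<in> pverts G \<and> x \<in> pverts G \<and> v \<in> pverts H \<and> y \<in> pverts H \<and>
        ((u, x) \<in> parcs G \<or> (u = x \<and> (v, y) \<in> parcs H))} \<rparr>"

text \<open>Domination in the closed sense, unlike the library's \<open>u \<rightarrow>\<^bsub>G\<^esub> v\<close>.\<close>

definition vdominates :: "'a pair_pre_digraph \<Rightarrow> 'a \<Rightarrow> 'a \<Rightarrow> bool" where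
  "vdominates F u v \<longleftrightarrow> u = v \<or> (u, v) \<in> parcs F"

definition double_dominating :: "'a pair_pre_digraph \<Rightarrow> 'a set \<Rightarrow> bool" where
  "double_dominating F S \<longleftrightarrow>
    S \<subseteq> pverts F \<and> (\<forall>v \<in> pverts F. card {u \<in> S. vdominates F u v} \<ge> 2)"

text \<open>
  For finite \<open>F\<close> the set below is finite, and it is nonempty if \<open>F\<close> has no isolated vertex
  (lemma \<open>double_dominating_pverts\<close>). Otherwise \<^const>\<open>Min\<close> is applied to the empty set
  and nothing is known about the value.
\<close>

definition double_dom_number :: "'a pair_pre_digraph \<Rightarrow> nat" where
  "double_dom_number F = Min (card ` {S. double_dominating F S})"

lemma pair_graph_lexicographic_product:
  assumes "pair_graph G" "pair_graph H"
  shows "pair_graph (lexicographic_product G H)"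
proof -
  interpret G: pair_graph G by fact
  interpret H: pair_graph H by fact
  have sub: "parcs (lexicographic_product G H) \<subseteq> (pverts G \<times> pverts H) \<times> (pverts G \<times> pverts H)"
    by (auto simp: lexicographic_product_def)
  have symG: "(x, u) \<in> parcs G" if "(u, x) \<in> parcs G" for u x
    using G.pair_sym_arcs that by (auto simp: symmetric_def dest: symD)
  have symH: "(x, u) \<in> parcs H" if "(u, x) \<in> parcs H" for u x
    using H.pair_sym_arcs that by (auto simp: symmetric_def dest: symD)
  show ?thesis
  proof
    show "finite (parcs (lexicographic_product G H))"
      using finite_subset[OF sub] G.pair_finite_verts H.pair_finite_verts by simp
    show "symmetric (with_proj (lexicographic_product G H))"
      unfolding symmetric_def by (auto simp: lexicographic_product_def intro!: symI dest: symG symH)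
  qed (use G.pair_finite_verts H.pair_finite_verts G.pair_no_loops H.pair_no_loops in
        \<open>auto simp: lexicographic_product_def\<close>)
qed

lemma double_dominating_pverts:
  assumes "pair_graph F" and "\<And>v. v \<in> pverts F \<Longrightarrow> \<exists>u. (u, v) \<in> parcs F"
  shows "double_dominating F (pverts F)"
  unfolding double_dominating_def
proof (intro conjI ballI)
  interpret F: pair_graph F by fact
  fix v assume v: "v \<in> pverts F"
  then obtain u where u: "(u, v) \<in> parcs F" using assms(2) by blast
  then have "u \<noteq> v" "u \<in> pverts F" using F.pair_no_loops[OF u] F.in_arcsD1 by auto
  then have "card {u, v} = 2" "{u, v} \<subseteq> {w \<in> pverts F. vdominates F w v}"
    using u v by (auto simp: vdominates_def)
  then show "2 \<le> card {w \<in> pverts F. vdominates F w v}"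
    using card_mono[of "{w \<in> pverts F. vdominates F w v}" "{u, v}"] F.pair_finite_verts by simp
qed simp

end

theory Submission
  imports Defs
begin

text \<open>
  If \<open>D\<close> is a total dominating set of \<open>G\<close> and \<open>h \<noteq> h'\<close> are vertices of \<open>H\<close>, then \<open>D \<times> {h, h'}\<close>
  is double dominating in the product, so it suffices that \<open>G\<close> has a total dominating set of size
  at most \<open>2n/3\<close> (for \<open>H\<close> a single vertex, the set of all vertices is small enough).

  Take a spanning tree rooted at a leaf \<open>r\<close>, and let \<open>L i\<close> be the set of vertices of level \<open>i\<close> modulo 3.
  For each \<open>i\<close>, the set \<open>V - L i\<close> can be turned into a total dominating set of the same size: it only
  misses the leaves just below a vertex \<open>p\<close> of \<open>L i\<close>, and swapping one such leaf for \<open>p\<close> repairs this.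
  The largest of the three classes has at least \<open>n/3\<close> vertices.
\<close>

section \<open>Rooted spanning trees from shortest paths\<close>

text \<open>The length of a shortest \<open>R\<close>-path from \<open>c\<close> serves as
  \<open>d\<close>: the penultimate vertex of such a path is exactly one step nearer. This supplies
  the parents in a breadth-first tree.\<close>

lemma rtrancl_rank_function:
  fixes R :: "('a \<times> 'a) set"
  obtains d :: "'a \<Rightarrow> nat" where
    "\<And>v. (c, v) \<in> R\<^sup>* \<Longrightarrow> v \<noteq> c \<Longrightarrow> \<exists>u. (c, u) \<in> R\<^sup>* \<and> (u, v) \<in> R \<and> d v = Suc (d u)"
proof
  define d where "d v = (LEAST k. (c, v) \<in> R ^^ k)" for v
  fix v assume v: "(c, v) \<in> R\<^sup>*" "v \<noteq> c"
  then obtain k where "(c, v) \<in> R ^^ k" by (auto simp: rtrancl_power)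
  then have dv: "(c, v) \<in> R ^^ d v" unfolding d_def by (rule LeastI)
  with v(2) obtain m where m: "d v = Suc m" by (cases "d v") auto
  with dv obtain u where u: "(c, u) \<in> R ^^ m" "(u, v) \<in> R" by auto
  have "(c, u) \<in> R ^^ d u" unfolding d_def using u(1) by (rule LeastI)
  then have "(c, v) \<in> R ^^ Suc (d u)" using u(2) by auto
  then have "d v \<le> Suc (d u)" unfolding d_def[of v] by (rule Least_le)
  moreover have "d u \<le> m" unfolding d_def using u(1) by (rule Least_le)
  ultimately have "d v = Suc (d u)" using m by simp
  then show "\<exists>u. (c, u) \<in> R\<^sup>* \<and> (u, v) \<in> R \<and> d v = Suc (d u)"
    using u relpow_imp_rtrancl by blast
qed

text \<open>A vertex \<open>r\<close> farthest from \<open>s\<close> works: a shortest path from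
  \<open>s\<close> to another vertex runs through strictly nearer vertices, so it avoids
  \<open>r\<close>. Hence \<open>r\<close> can be a leaf of a spanning tree, attached at
  \<open>c\<close>.\<close>

lemma exists_non_cut_vertex:
  fixes E :: "('a \<times> 'a) set"
  assumes fin: "finite V" and EV: "E \<subseteq> V \<times> V" and sym: "sym E"
    and conn: "\<And>u v. u \<in> V \<Longrightarrow> v \<in> V \<Longrightarrow> (u, v) \<in> E\<^sup>*"
    and s: "s \<in> V" and nontriv: "V \<noteq> {s}"
  obtains r c where "r \<in> V" "c \<in> V" "r \<noteq> c" "(c, r) \<in> E"
    "\<And>v. v \<in> V \<Longrightarrow> v \<noteq> r \<Longrightarrow> (c, v) \<in> (E \<inter> (V - {r}) \<times> (V - {r}))\<^sup>*"
proof -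
  obtain d :: "'a \<Rightarrow> nat" where
    "\<And>v. (s, v) \<in> E\<^sup>* \<Longrightarrow> v \<noteq> s \<Longrightarrow> \<exists>u. (s, u) \<in> E\<^sup>* \<and> (u, v) \<in> E \<and> d v = Suc (d u)"
    using rtrancl_rank_function[of s E] by blast
  then have d: "\<exists>u. u \<in> V \<and> (u, v) \<in> E \<and> d v = Suc (d u)" if "v \<in> V" "v \<noteq> s" for v
    using conn[OF s] that EV by blast
  have ne: "V - {s} \<noteq> {}" using s nontriv by auto
  then have "Max (d ` (V - {s})) \<in> d ` (V - {s})" using fin by (intro Max_in) auto
  then obtain r where "Max (d ` (V - {s})) = d r" "r \<in> V - {s}" by (rule imageE)
  then have r: "r \<in> V" "r \<noteq> s" "d r = Max (d ` (V - {s}))" by simp_all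
  have max: "d v \<le> d r" if "v \<in> V" "v \<noteq> s" for v
    unfolding r(3) using fin that by (intro Max_ge) auto
  define R where "R = E \<inter> (V - {r}) \<times> (V - {r})"
  have "sym R" using sym unfolding R_def sym_def by blast
  have reach: "(s, v) \<in> R\<^sup>*" if "v \<in> V" "v \<noteq> r" for v
    using that
  proof (induction "d v" arbitrary: v rule: less_induct)
    case less
    show ?case
    proof (cases "v = s")
      case False
      then obtain u where u: "u \<in> V" "(u, v) \<in> E" "d v = Suc (d u)" using d less.prems by blast
      then have "u \<noteq> r" using max[OF less.prems(1) False] by auto
      then show ?thesis
        using less.hyps[of u] u less.prems by (auto simp: R_def intro: rtrancl_into_rtrancl)
    qed simp
  qed
  obtain c where c: "c \<in> V" "(c, r) \<in> E" "d r = Suc (d c)" using d r by blast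
  then have "r \<noteq> c" by auto
  \<comment> \<open>Deleting \<open>r\<close> keeps the relation symmetric, so the base point can
    move from \<open>s\<close> to \<open>c\<close>.\<close>
  have "(c, s) \<in> R\<^sup>*"
    using reach[of c] c \<open>r \<noteq> c\<close> sym_rtrancl[OF \<open>sym R\<close>] by (auto dest: symD)
  then have "(c, v) \<in> R\<^sup>*" if "v \<in> V" "v \<noteq> r" for v
    using reach[OF that] by (rule rtrancl_trans)
  then show thesis using that r(1) c \<open>r \<noteq> c\<close> unfolding R_def by blast
qed

text \<open>
  The root \<open>r\<close> and its only child \<open>c\<close> are made parents of each other, so that \<open>r\<close> can play the
  part of a leaf below \<open>c\<close> when the level of \<open>c\<close> is removed.
\<close>

lemma exists_levels_from_leaf:
  fixes E :: "('a \<times> 'a) set"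
  assumes fin: "finite V" and EV: "E \<subseteq> V \<times> V" and sym: "sym E"
    and conn: "\<And>u v. u \<in> V \<Longrightarrow> v \<in> V \<Longrightarrow> (u, v) \<in> E\<^sup>*" and card: "card V \<ge> 3"
  obtains r c par w and l :: "'a \<Rightarrow> nat" where
    "r \<in> V" "c \<in> V" "r \<noteq> c" "par r = c" "par c = r" "w \<in> V" "w \<noteq> r" "par w = c" "l r = 0"
    "\<And>v. v \<in> V \<Longrightarrow> par v \<in> V \<and> (par v, v) \<in> E"
    "\<And>v. v \<in> V \<Longrightarrow> v \<noteq> r \<Longrightarrow> l v = Suc (l (par v))"
    "\<And>v. v \<in> V \<Longrightarrow> par v = r \<Longrightarrow> v = c"
proof -
  obtain s where s: "s \<in> V" using card by fastforce
  have "V \<noteq> {s}" using card by auto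
  then obtain r c where r: "r \<in> V" "c \<in> V" "r \<noteq> c" "(c, r) \<in> E"
    and reach: "\<And>v. v \<in> V \<Longrightarrow> v \<noteq> r \<Longrightarrow> (c, v) \<in> (E \<inter> (V - {r}) \<times> (V - {r}))\<^sup>*"
    using exists_non_cut_vertex[OF fin EV sym conn s] by blast
  obtain d :: "'a \<Rightarrow> nat" where
    "\<And>v. (c, v) \<in> (E \<inter> (V - {r}) \<times> (V - {r}))\<^sup>* \<Longrightarrow> v \<noteq> c \<Longrightarrow>
       \<exists>u. (c, u) \<in> (E \<inter> (V - {r}) \<times> (V - {r}))\<^sup>* \<and>
         (u, v) \<in> E \<inter> (V - {r}) \<times> (V - {r}) \<and> d v = Suc (d u)"
    using rtrancl_rank_function[of c "E \<inter> (V - {r}) \<times> (V - {r})"] by blast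
  then have "\<forall>v \<in> V - {r, c}. \<exists>u. u \<in> V - {r} \<and> (u, v) \<in> E \<and> d v = Suc (d u)"
    using reach by blast
  then obtain p where p: "\<And>v. v \<in> V \<Longrightarrow> v \<noteq> r \<Longrightarrow> v \<noteq> c \<Longrightarrow>
      p v \<in> V \<and> p v \<noteq> r \<and> (p v, v) \<in> E \<and> d v = Suc (d (p v))"
    by (metis Diff_iff insert_iff empty_iff)
  have "\<not> V \<subseteq> {r, c}"
    using card card_mono[of "{r, c}" V] r(3) by auto
  then obtain v where v: "v \<in> V" "v \<noteq> r" "v \<noteq> c" by auto
  \<comment> \<open>A vertex of least rank outside \<open>{r, c}\<close> must have parent
    \<open>c\<close>, since any other parent would rank lower. So \<open>c\<close> has a child
    besides \<open>r\<close>.\<close>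
  define w where "w = arg_min d (\<lambda>v. v \<in> V - {r, c})"
  have w: "w \<in> V - {r, c}" and min: "\<And>v. v \<in> V - {r, c} \<Longrightarrow> d w \<le> d v"
    unfolding w_def using v arg_min_nat_lemma[of "\<lambda>v. v \<in> V - {r, c}" v d] by auto
  have pw: "p w = c"
    using p[of w] min[of "p w"] w by (cases "p w = c") auto
  define par where "par = p(r := c, c := r)"
  \<comment> \<open>The value \<open>d c\<close> is unspecified, so levels are measured relative to
    it; \<open>dc\<close> below makes the truncated subtraction exact. The shift by one leaves level
    0 to \<open>r\<close>.\<close>
  define l where "l v = (if v = r then 0 else if v = c then 1 else Suc (d v - d c))" for v
  have dc: "d c \<le> d v" if "v \<in> V - {r}" for v
  proof (cases "v = c")
    case False
    then show ?thesis using min[of v] p[of w] w pw that by auto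
  qed simp
  show thesis
  proof (rule that[of r c par w l])
    show "v = c" if "v \<in> V" "par v = r" for v
      using that p[of v] r by (auto simp: par_def split: if_splits)
    show "par v \<in> V \<and> (par v, v) \<in> E" if "v \<in> V" for v
      using that p[of v] r symD[OF sym r(4)] by (auto simp: par_def)
    show "l v = Suc (l (par v))" if "v \<in> V" "v \<noteq> r" for v
      using that p[of v] r dc[of "p v"] by (auto simp: par_def l_def)
  qed (use r p w pw in \<open>auto simp: par_def l_def\<close>)
qed

section \<open>Total domination by at most two thirds of the vertices\<close>

text \<open>Only tree edges are used to dominate, so the parent map and the levels stand in for the
  graph.\<close>

lemma levels_total_domination:
  fixes l :: "'a \<Rightarrow> nat"
  assumes fin: "finite V" and r: "r \<in> V" "par r = c" "l r = 0" and c: "c \<in> V" "par c = r" "r \<noteq> c"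
    and w: "w \<in> V" "w \<noteq> r" "par w = c"
    and par: "\<And>v. v \<in> V \<Longrightarrow> par v \<in> V"
    and lev: "\<And>v. v \<in> V \<Longrightarrow> v \<noteq> r \<Longrightarrow> l v = Suc (l (par v))"
    and par_r: "\<And>v. v \<in> V \<Longrightarrow> par v = r \<Longrightarrow> v = c"
  shows "\<exists>D \<subseteq> V. 3 * card D \<le> 2 * card V \<and> (\<forall>v\<in>V. \<exists>u \<in> D. u = par v \<or> par u = v)"
proof -
  define L where "L i = {v \<in> V. l v mod 3 = i}" for i
  have lc: "l c = 1" using lev[of c] c r by auto
  have total: "\<exists>D \<subseteq> V. card D = card V - card (L i) \<and> (\<forall>v\<in>V. \<exists>u \<in> D. u = par v \<or> par u = v)"
    if "i < 3" for i
  proof -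
    \<comment> \<open>\<open>B\<close>: the vertices that \<open>V - L i\<close> fails to dominate\<close>
    define B where "B = {v \<in> V. l v mod 3 = Suc i mod 3 \<and> v \<notin> par ` (V - {r})} \<union> {v. v = r \<and> i = 1}"
    define P where "P = par ` B"
    \<comment> \<open>When several members of \<open>B\<close> share a parent, only one of them
      enters \<open>X\<close>; the others stay in \<open>D\<close>. Exchanging \<open>X\<close> for
      \<open>P\<close> therefore preserves the cardinality.\<close>
    define sel where "sel = inv_into B par"
    define X where "X = sel ` P"
    have sel: "sel p \<in> B" "par (sel p) = p" if "p \<in> P" for p
      using that unfolding sel_def P_def by (auto intro: inv_into_into f_inv_into_f)
    have XB: "X \<subseteq> B" using sel by (auto simp: X_def)
    have BV: "B \<subseteq> V" using r by (auto simp: B_def)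
    have B_lev: "b = r \<and> i = 1 \<or> b \<noteq> r \<and> l b mod 3 = Suc i mod 3" if "b \<in> B" for b
      using that c r by (auto simp: B_def)
    \<comment> \<open>The exchange never discards a vertex that has a child, apart from
      \<open>r\<close>, which lies in \<open>B\<close> for \<open>i = 1\<close> although
      \<open>c\<close> is its child. That exception is the case \<open>top\<close> below.\<close>
    have par_notin_B: "par v \<notin> B" if "v \<in> V" "v \<noteq> r" "par v \<noteq> r" for v
      using that by (auto simp: B_def)
    have "Suc i mod 3 \<noteq> i" using \<open>i < 3\<close> by (simp add: mod_Suc)
    then have "l b mod 3 \<noteq> i" if "b \<in> B" for b
      using B_lev[OF that] r(3) by auto
    then have BL: "B \<inter> L i = {}" by (auto simp: L_def)
    have PL: "P \<subseteq> L i"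
    proof
      fix p assume "p \<in> P"
      then obtain b where b: "b \<in> B" "p = par b" by (auto simp: P_def)
      have "l (par b) mod 3 = i"
      proof (cases "b = r")
        case True
        then show ?thesis using B_lev[OF b(1)] r lc by auto
      next
        case False
        then have "Suc (l (par b)) mod 3 = Suc i mod 3"
          using B_lev[OF b(1)] lev[of b] b(1) BV by auto
        then show ?thesis using \<open>i < 3\<close> by (simp add: mod_Suc split: if_splits)
      qed
      then show "p \<in> L i" using b BV par by (auto simp: L_def)
    qed
    have LV: "L i \<subseteq> V" by (auto simp: L_def)
    define D where "D = (V - L i - X) \<union> P"
    have DV: "D \<subseteq> V" using PL LV by (auto simp: D_def)
    have finP: "finite P" using PL LV fin by (meson finite_subset)
    have "inj_on sel P" using sel(2) by (metis inj_onI)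
    then have "card X = card P" unfolding X_def by (rule card_image)
    moreover have "card D = card (V - L i - X) + card P"
      unfolding D_def using fin finP PL by (intro card_Un_disjoint) auto
    moreover have "X \<subseteq> V - L i" using XB BV BL by auto
    then have "card (V - L i - X) = card (V - L i) - card X" "card X \<le> card (V - L i)"
      using fin by (auto intro!: card_Diff_subset card_mono dest: finite_subset)
    moreover have "card (V - L i) = card V - card (L i)"
      using LV fin by (intro card_Diff_subset) (auto dest: finite_subset)
    ultimately have cardD: "card D = card V - card (L i)" by simp
    have inD: "u \<in> D" if "u \<in> V" "l u mod 3 \<noteq> i" "u \<notin> X" for u
      using that by (auto simp: D_def L_def)
    have "\<exists>u \<in> D. u = par v \<or> par u = v" if v: "v \<in> V" for v
    proof -
      consider (B) "v \<in> B" | (root) "v \<notin> B" "v = r"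
        | (inner) "v \<notin> B" "v \<noteq> r" "l v mod 3 = Suc i mod 3"
        | (top) "v \<noteq> r" "par v = r" "l v mod 3 \<noteq> Suc i mod 3"
        | (up) "v \<noteq> r" "par v \<noteq> r" "l v mod 3 \<noteq> Suc i mod 3"
        by blast
      then show ?thesis
      proof cases
        case B
        then show ?thesis by (auto simp: D_def P_def)
      next
        case root
        then have "i \<noteq> 1" by (auto simp: B_def r)
        \<comment> \<open>The child \<open>w\<close> keeps \<open>c\<close> out of
          \<open>B\<close>.\<close>
        moreover have "c \<notin> X" using par_notin_B[of w] w XB c by auto
        ultimately have "c \<in> D" using inD[of c] c lc by auto
        then show ?thesis using root c by auto
      next
        case inner
        \<comment> \<open>A child of \<open>v\<close> lies two levels beyond class \<open>i\<close>,
          hence neither in \<open>L i\<close> nor in \<open>B\<close>, and so survives in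
          \<open>D\<close>.\<close>
        then obtain u where u: "u \<in> V" "u \<noteq> r" "par u = v" using v by (auto simp: B_def)
        then have "l u mod 3 \<noteq> i" "l u mod 3 \<noteq> Suc i mod 3"
          using lev[of u] inner(3) \<open>i < 3\<close> by (auto simp: mod_Suc split: if_splits)
        then show ?thesis using u inD[of u] B_lev[of u] XB by auto
      next
        case top
        then have vc: "v = c" using par_r v by blast
        then have i0: "i \<noteq> 0" using top lc by (cases i) auto
        \<comment> \<open>Normally \<open>r\<close> dominates \<open>c\<close>. If \<open>r\<close>
          was exchanged, it is the one child selected for \<open>c\<close>, so \<open>w\<close> was
          not selected and dominates \<open>c\<close> instead.\<close>
        show ?thesis
        proof (cases "r \<in> X")
          case False
          then have "r \<in> D" using inD[of r] r i0 by auto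
          then show ?thesis using top by auto
        next
          case True
          then have "sel c = r" using sel(2) r by (auto simp: X_def)
          then have "w \<notin> X" using sel(2) w by (auto simp: X_def)
          moreover have "i = 1" using True XB B_lev[of r] by auto
          moreover have "l w = 2" using lev[of w] w lc by auto
          ultimately have "w \<in> D" using inD[of w] w by auto
          then show ?thesis using w vc by auto
        qed
      next
        case up
        then have "l (par v) mod 3 \<noteq> i" using lev[OF v] by (metis mod_Suc_eq)
        then have "par v \<in> D" using inD[of "par v"] par[OF v] par_notin_B[OF v] up XB by auto
        then show ?thesis by auto
      qed
    qed
    then show ?thesis using DV cardD by blast
  qed
  have "V = L 0 \<union> L 1 \<union> L 2" unfolding L_def by auto
  then have "card V = card (L 0 \<union> L 1 \<union> L 2)" by simp
  also have "\<dots> \<le> card (L 0) + card (L 1) + card (L 2)"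
    by (meson card_Un_le add_right_mono le_trans)
  finally have "card V \<le> 3 * card (L 0) \<or> card V \<le> 3 * card (L 1) \<or> card V \<le> 3 * card (L 2)"
    by linarith
  moreover have "(0::nat) < 3" "(1::nat) < 3" "(2::nat) < 3" by simp_all
  ultimately obtain i where i: "i < 3" "card V \<le> 3 * card (L i)" by blast
  obtain D where "D \<subseteq> V" "card D = card V - card (L i)"
    "\<forall>v\<in>V. \<exists>u \<in> D. u = par v \<or> par u = v"
    using total[OF i(1)] by blast
  moreover have "3 * (card V - card (L i)) \<le> 2 * card V" using i(2) by linarith
  ultimately show ?thesis by (intro exI[of _ D]) simp
qed

lemma total_domination_two_thirds:
  fixes E :: "('a \<times> 'a) set"
  assumes fin: "finite V" and EV: "E \<subseteq> V \<times> V" and sym: "sym E"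
    and conn: "\<And>u v. u \<in> V \<Longrightarrow> v \<in> V \<Longrightarrow> (u, v) \<in> E\<^sup>*" and card: "card V \<ge> 3"
  obtains D where "D \<subseteq> V" "3 * card D \<le> 2 * card V" "\<And>v. v \<in> V \<Longrightarrow> \<exists>u \<in> D. (u, v) \<in> E"
proof (rule exists_levels_from_leaf[OF assms])
  fix r c par w and l :: "'a \<Rightarrow> nat"
  assume *: "r \<in> V" "c \<in> V" "r \<noteq> c" "par r = c" "par c = r" "w \<in> V" "w \<noteq> r" "par w = c" "l r = 0"
    and par: "\<And>v. v \<in> V \<Longrightarrow> par v \<in> V \<and> (par v, v) \<in> E"
    and lev: "\<And>v. v \<in> V \<Longrightarrow> v \<noteq> r \<Longrightarrow> l v = Suc (l (par v))"
    and par_r: "\<And>v. v \<in> V \<Longrightarrow> par v = r \<Longrightarrow> v = c"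
  have "par v \<in> V" if "v \<in> V" for v using par[OF that] by simp
  then obtain D where D: "D \<subseteq> V" "3 * card D \<le> 2 * card V"
    "\<forall>v\<in>V. \<exists>u \<in> D. u = par v \<or> par u = v"
    using levels_total_domination[OF fin *(1,4,9,2,5,3,6,7,8) _ lev par_r] by blast
  \<comment> \<open>A dominating parent gives an edge directly, a dominating child by
    symmetry.\<close>
  have "\<exists>u \<in> D. (u, v) \<in> E" if "v \<in> V" for v
    using D(3) par that D(1) symD[OF sym] by blast
  with D(1,2) show thesis by (rule that)
qed

section \<open>Double domination in the lexicographic product\<close>

lemma double_dom_number_le:
  assumes "finite (pverts F)" "double_dominating F S"
  shows "double_dom_number F \<le> card S"
proof -
  have "{S. double_dominating F S} \<subseteq> Pow (pverts F)" by (auto simp: double_dominating_def)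
  then have "finite {S. double_dominating F S}" using assms(1) by (simp add: finite_subset)
  then show ?thesis unfolding double_dom_number_def using assms(2) by (intro Min_le) auto
qed

text \<open>A neighbour \<open>u\<close> of \<open>v\<close> in \<open>D\<close> makes both
  \<open>(u, h)\<close> and \<open>(u, h')\<close> adjacent to \<open>(v, y)\<close>, whatever
  \<open>y\<close> is. With \<open>u = v\<close> this would depend on edges of \<open>H\<close>,
  hence total domination.\<close>

lemma double_dominating_total_times_pair:
  assumes fin: "finite (pverts G)" "finite (pverts H)" and D: "D \<subseteq> pverts G"
    and total: "\<And>v. v \<in> pverts G \<Longrightarrow> \<exists>u \<in> D. (u, v) \<in> parcs G"
    and h: "h \<in> pverts H" "h' \<in> pverts H" "h \<noteq> h'"
  shows "double_dominating (lexicographic_product G H) (D \<times> {h, h'})"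
  unfolding double_dominating_def
proof (intro conjI ballI)
  show "D \<times> {h, h'} \<subseteq> pverts (lexicographic_product G H)"
    using D h by (auto simp: lexicographic_product_def)
  fix x assume "x \<in> pverts (lexicographic_product G H)"
  then obtain v y where x: "x = (v, y)" "v \<in> pverts G" "y \<in> pverts H"
    by (auto simp: lexicographic_product_def)
  obtain u where u: "u \<in> D" "(u, v) \<in> parcs G" using total x by blast
  have "{(u, h), (u, h')} \<subseteq> {z \<in> D \<times> {h, h'}. vdominates (lexicographic_product G H) z x}"
    using u x h D by (auto simp: vdominates_def lexicographic_product_def)
  moreover have "finite D" using D fin(1) by (rule finite_subset)
  then have "finite {z \<in> D \<times> {h, h'}. vdominates (lexicographic_product G H) z x}" by simp
  ultimately have "card {(u, h), (u, h')} \<le> card {z \<in> D \<times> {h, h'}. vdominates (lexicographic_product G H) z x}"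
    by (intro card_mono)
  then show "2 \<le> card {z \<in> D \<times> {h, h'}. vdominates (lexicographic_product G H) z x}"
    using h by simp
qed

theorem theorem2p5:
  fixes G :: "'a pair_pre_digraph" and H :: "'b pair_pre_digraph" and n :: nat
  assumes "pair_graph G" and "Digraph_Component.connected (with_proj G)"
    and "card (pverts G) = n" and "n \<ge> 3"
    and "pair_graph H" and "pverts H \<noteq> {}"
  shows "int (double_dom_number (lexicographic_product G H)) \<le> 2 * \<lfloor>2 * real n / 3\<rfloor>"
proof -
  interpret G: pair_graph G by fact
  interpret H: pair_graph H by fact
  interpret P: pair_graph "lexicographic_product G H"
    using assms(1,5) by (rule pair_graph_lexicographic_product)
  have arcsV: "parcs G \<subseteq> pverts G \<times> pverts G"
    using G.in_arcsD1 G.in_arcsD2 by auto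
  have sym: "sym (parcs G)" using G.pair_sym_arcs by (simp add: symmetric_def)
  have "strongly_connected (with_proj G)"
    using G.symmetric_connected_imp_strongly_connected G.sym_arcs assms(2) by simp
  then have conn: "(u, v) \<in> (parcs G)\<^sup>*" if "u \<in> pverts G" "v \<in> pverts G" for u v
    using that rtrancl_on_rtranclI[of u v "pverts G" "parcs G"]
    by (auto simp: strongly_connected_def reachable_def)
  have card: "card (pverts G) \<ge> 3" using assms by simp
  obtain D where D: "D \<subseteq> pverts G" "3 * card D \<le> 2 * card (pverts G)"
    "\<And>v. v \<in> pverts G \<Longrightarrow> \<exists>u \<in> D. (u, v) \<in> parcs G"
    using total_domination_two_thirds[OF G.pair_finite_verts arcsV sym conn card] by blast
  have floor: "\<lfloor>2 * real n / 3\<rfloor> = int (2 * n div 3)"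
    using floor_divide_of_nat_eq[of "2 * n" 3] by simp
  obtain h where h: "h \<in> pverts H" using assms(6) by blast
  have "double_dom_number (lexicographic_product G H) \<le> 2 * (2 * n div 3)"
  proof (cases "pverts H = {h}")
    case True
    \<comment> \<open>No pair \<open>h\<close>, \<open>h'\<close> exists here. The product is a copy
      of \<open>G\<close>, which \<open>D\<close> shows to have no isolated vertex, so all
      \<open>n\<close> vertices may be taken.\<close>
    have "\<exists>u. (u, v) \<in> parcs (lexicographic_product G H)"
      if "v \<in> pverts (lexicographic_product G H)" for v
      using that D(1) D(3)[of "fst v"] h by (fastforce simp: lexicographic_product_def)
    then have "double_dominating (lexicographic_product G H) (pverts (lexicographic_product G H))"
      by (intro double_dominating_pverts P.pair_graph_axioms)
    then have "double_dom_number (lexicographic_product G H) \<le> card (pverts (lexicographic_product G H))"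
      by (intro double_dom_number_le P.pair_finite_verts)
    also have "\<dots> = n" using True assms(3) by (simp add: lexicographic_product_def card_cartesian_product)
    also have "\<dots> \<le> 2 * (2 * n div 3)" using assms(4) by presburger
    finally show ?thesis .
  next
    case False
    then obtain h' where "h' \<in> pverts H" "h \<noteq> h'" using h by blast
    then have "double_dom_number (lexicographic_product G H) \<le> card (D \<times> {h, h'})"
      using D h by (intro double_dom_number_le P.pair_finite_verts double_dominating_total_times_pair) auto
    also have "\<dots> = 2 * card D" using \<open>h \<noteq> h'\<close> by (simp add: card_cartesian_product)
    \<comment> \<open>The bound on \<open>card D\<close> is rounded down before doubling, which is
      what puts the floor inside the factor 2.\<close>
    also have "\<dots> \<le> 2 * (2 * n div 3)" using D(2) assms(3) by auto
    finally show ?thesis .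
  qed
  then show ?thesis unfolding floor by linarith
qed

end
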